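(* Let $S$ be a semigroup, let $E$ be a real dual locally convex space with real predual locally convex space $D$, and let $U$ be a convex neighbourhood of $0$ in $D$. Let $f:S\to E$ be a function such that $\langle x,f(t)\rangle\le 1$ for each $t\in S$ and $x\in U$. Let $X$ be a subspace of $B(S)$ such that the mapping $t\mapsto\langle x,f(t)\rangle$ is an element of $X$ for each $x\in D$. Then, for any $\mu\in X^*$, there exists a unique element $F_\mu\in E$ such that $$\langle x,F_\mu\rangle=\mu_t\langle x,f(t)\rangle\quad\text{for all }x\in D.$$ Furthermore, if $1\in X$ and $\mu$ is a mean on $X$, then $F_\mu$ is contained in $\overline{\mathrm{co}\{f(t):t\in S\}}^{\,w^*}$.
   Context: $E$ is a dual locally convex space with predual $D$ means that $E=D^*$ is the space of continuous linear functionals on the locally convex space $D$; $\langle x,e\rangle$ denotes the value of $e\in E$ at $x\in D$, and $w^*$ denotes the weak$^*$ topology on $E$ (pointwise convergence on $D$). $B(S)$ is the space of bounded real-valued functions on $S$ with the supremum norm, and $X^*$ is the topological dual of $X$ for this norm. For $\mu\in X^*$ and $g\in X$, $\mu_t(g(t))$ denotes $\mu(g)$. A mean on $X$ (when $1\in X$) is $\mu\in X^*$ with $\|\mu\|=\mu(1)=1$. $\mathrm{co}$ denotes convex hull. *)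

theory Defs
  imports "HOL-Analysis.Analysis" "HOL-Library.Function_Algebras"
begin

text \<open>
  Real-valued functions form a real vector space under the pointwise operations, so that
  \<^const>\<open>subspace\<close> and \<^const>\<open>hull\<close> apply both to subspaces of $B(S)$ and to subsets of $D^*$.
\<close>

instantiation "fun" :: (type, real_vector) real_vector
begin

definition scaleR_fun_def: "c *\<^sub>R f = (\<lambda>x. c *\<^sub>R f x)"

instance
  by standard (simp_all add: scaleR_fun_def fun_eq_iff scaleR_add_right scaleR_add_left)

end

lemma scaleR_fun_apply [simp]: "(c *\<^sub>R f) x = c *\<^sub>R f x"
  by (simp add: scaleR_fun_def)

text \<open>
  Joint continuity of addition and scalar multiplication is phrased with product filters, as in
  \<^class>\<open>topological_monoid_add\<close>. The Hausdorff property is not assumed.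
\<close>

class topological_vector_space = real_vector + topological_ab_group_add +
  assumes tendsto_scaleR_Pair: "LIM p (nhds c \<times>\<^sub>F nhds x). fst p *\<^sub>R snd p :> nhds (c *\<^sub>R x)"

text \<open>
  A class axiom cannot mention \<^const>\<open>convex\<close> or \<^const>\<open>interior\<close>, so both are unfolded here;
  see \<open>convex_nhds_base\<close> below.
\<close>

class locally_convex_space = topological_vector_space +
  assumes convex_nhds_base_raw:
    "open W \<Longrightarrow> 0 \<in> W \<Longrightarrow>
      \<exists>V T. (\<forall>x\<in>V. \<forall>y\<in>V. \<forall>u\<ge>0. \<forall>v\<ge>0. u + v = 1 \<longrightarrow> u *\<^sub>R x + v *\<^sub>R y \<in> V) \<and>
        open T \<and> 0 \<in> T \<and> T \<subseteq> V \<and> V \<subseteq> W"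

lemma convex_nhds_base:
  fixes W :: "'d::locally_convex_space set"
  assumes "0 \<in> interior W"
  obtains V where "convex V" "0 \<in> interior V" "V \<subseteq> W"
proof -
  obtain V T where "convex V" "open T" "0 \<in> T" "T \<subseteq> V" "V \<subseteq> interior W"
    using convex_nhds_base_raw[OF open_interior assms] unfolding convex_def by blast
  then show thesis
    using that[of V] interior_subset[of W] by (meson interior_maximal subset_iff)
qed

definition continuous_dual :: "('d::locally_convex_space \<Rightarrow> real) set" where
  "continuous_dual = {e. linear e \<and> continuous_on UNIV e}"

definition weak_star :: "('d::locally_convex_space \<Rightarrow> real) topology" where
  "weak_star = subtopology (powertop_real UNIV) continuous_dual"

definition bounded_functions :: "('s \<Rightarrow> real) set" where
  "bounded_functions = {g. bounded (range g)}"

definition sup_norm :: "('s \<Rightarrow> real) \<Rightarrow> real" where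
  "sup_norm g = (SUP t. \<bar>g t\<bar>)"

text \<open>
  The dual $X^*$ for the supremum norm. Its elements are functions on all of \<^typ>\<open>'s \<Rightarrow> real\<close>,
  but only their values on $X$ are constrained or used; in particular the dual norm is taken
  over the unit ball of $X$.
\<close>

definition sup_dual :: "('s \<Rightarrow> real) set \<Rightarrow> (('s \<Rightarrow> real) \<Rightarrow> real) set" where
  "sup_dual X = {\<mu>.
     (\<forall>g\<in>X. \<forall>h\<in>X. \<mu> (g + h) = \<mu> g + \<mu> h) \<and>
     (\<forall>c. \<forall>g\<in>X. \<mu> (c *\<^sub>R g) = c * \<mu> g) \<and>
     (\<forall>g\<in>X. \<forall>\<epsilon>>0. \<exists>\<delta>>0. \<forall>h\<in>X. sup_norm (h - g) < \<delta> \<longrightarrow> \<bar>\<mu> h - \<mu> g\<bar> < \<epsilon>)}"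

definition dual_norm :: "('s \<Rightarrow> real) set \<Rightarrow> (('s \<Rightarrow> real) \<Rightarrow> real) \<Rightarrow> real" where
  "dual_norm X \<mu> = (SUP g\<in>{g \<in> X. sup_norm g \<le> 1}. \<bar>\<mu> g\<bar>)"

definition is_mean :: "('s \<Rightarrow> real) set \<Rightarrow> (('s \<Rightarrow> real) \<Rightarrow> real) \<Rightarrow> bool" where
  "is_mean X \<mu> \<longleftrightarrow> \<mu> \<in> sup_dual X \<and> dual_norm X \<mu> = 1 \<and> \<mu> 1 = 1"

end

theory Submission
  imports Defs
begin

text \<open>
  Since \<open>\<bar>f t x\<bar> \<le> \<delta>\<close> for all \<open>t\<close> whenever \<open>x\<close> lies in the $0$-neighbourhood $\delta U \cap -\delta U$,
  norm continuity of \<open>\<mu>\<close> makes \<open>x \<mapsto> \<mu> (\<lambda>t. f t x)\<close> continuous at $0$. For the closure statement no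
  separation theorem is needed: on finitely many coordinates, the squared distance from \<open>F\<close> to a
  point \<open>g\<close> of the convex hull is decreased by a definite amount on moving from \<open>g\<close> towards a
  suitable \<open>f t\<close>, and such a \<open>t\<close> exists because a mean of a function is at least its infimum.
\<close>

section \<open>Least squares over a convex set\<close>

text \<open>If the infimum \<open>m\<close> of \<open>Q\<close> were positive, a step of length
  \<open>s\<close> from a near-minimiser \<open>g\<close> towards \<open>h\<close> would change
  \<open>Q\<close> to first order by \<open>2 * s * (P - Q g)\<close>, where \<open>P\<close> is the
  mixed sum in \<open>descent\<close>. With \<open>P < m / 4\<close> this is a definite decrease,
  and it beats the quadratic error for small \<open>s\<close>. As \<open>B\<close> does not depend
  on \<open>g\<close>, the length \<open>s\<close> can be fixed before \<open>g\<close> is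
  chosen.\<close>

lemma convex_sum_squares_approx:
  fixes K :: "('i \<Rightarrow> real) set" and F :: "'i \<Rightarrow> real" and J :: "'i set"
  defines "Q \<equiv> \<lambda>g. \<Sum>j\<in>J. (g j - F j)\<^sup>2"
  assumes "convex K" "K \<noteq> {}"
    and descent: "\<And>g \<eta>. g \<in> K \<Longrightarrow> \<eta> > 0 \<Longrightarrow>
      \<exists>h\<in>K. Q h \<le> B \<and> (\<Sum>j\<in>J. (g j - F j) * (h j - F j)) < \<eta>"
    and "\<epsilon> > 0"
  shows "\<exists>g\<in>K. Q g < \<epsilon>"
proof (rule ccontr)
  assume "\<not> ?thesis"
  then have large: "\<epsilon> \<le> Q g" if "g \<in> K" for g
    using that by (meson not_le)
  define m where "m = (INF g\<in>K. Q g)"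
  have "\<epsilon> \<le> m"
    unfolding m_def using \<open>K \<noteq> {}\<close> large by (intro cINF_greatest)
  then have "m > 0" using \<open>\<epsilon> > 0\<close> by simp
  have bdd: "bdd_below (Q ` K)"
    using large by (intro bdd_belowI2)
  have m_le: "m \<le> Q g" if "g \<in> K" for g
    unfolding m_def using bdd that by (intro cINF_lower)
  have "B \<ge> 0"
  proof -
    obtain g where "g \<in> K" using \<open>K \<noteq> {}\<close> by blast
    then obtain h where "h \<in> K" "Q h \<le> B" using descent[of g 1] by auto
    then show ?thesis using m_le[of h] \<open>m > 0\<close> by simp
  qed
  \<comment> \<open>\<open>C\<close> bounds the coefficient of \<open>s\<^sup>2\<close>, from
    \<open>Q g \<le> m + 1\<close> and \<open>Q h \<le> B\<close>. The choice of \<open>s\<close>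
    turns that error into \<open>s * m / 2\<close>, leaving a net gain of
    \<open>s * m\<close>.\<close>
  define C where "C = m + 1 + B"
  define s where "s = m / (2 * C)"
  have "C > 0" "m \<le> C" using \<open>m > 0\<close> \<open>B \<ge> 0\<close> by (auto simp: C_def)
  have s: "s > 0" "s \<le> 1" "s * C = m / 2"
    using \<open>C > 0\<close> \<open>m \<le> C\<close> \<open>m > 0\<close> by (auto simp: s_def field_simps)
  have "s * m > 0" using s \<open>m > 0\<close> by simp
  \<comment> \<open>The excess of \<open>Q g\<close> over \<open>m\<close> must stay below the gain
    \<open>s * m\<close>; the cap 1 gives the bound \<open>m + 1\<close> built into
    \<open>C\<close>.\<close>
  have "Inf (Q ` K) < m + min 1 (s * m)"
    using \<open>s * m > 0\<close> by (simp add: m_def)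
  then obtain g where g: "g \<in> K" "Q g < m + min 1 (s * m)"
    using cInf_lessD[of "Q ` K"] \<open>K \<noteq> {}\<close> by auto
  obtain h where h: "h \<in> K" "Q h \<le> B" "(\<Sum>j\<in>J. (g j - F j) * (h j - F j)) < m / 4"
    using descent[OF g(1), of "m / 4"] \<open>m > 0\<close> by auto
  define P where "P = (\<Sum>j\<in>J. (g j - F j) * (h j - F j))"
  define k where "k = (1 - s) *\<^sub>R g + s *\<^sub>R h"
  have "k \<in> K"
    unfolding k_def using \<open>convex K\<close> g(1) h(1) s by (intro convexD) auto
  have "Q k = (\<Sum>j\<in>J. (1 - s)\<^sup>2 * (g j - F j)\<^sup>2 + 2 * s * (1 - s) * ((g j - F j) * (h j - F j))
      + s\<^sup>2 * (h j - F j)\<^sup>2)"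
    unfolding Q_def k_def
    by (intro sum.cong refl) (simp add: power2_eq_square algebra_simps)
  also have "\<dots> = (1 - s)\<^sup>2 * Q g + 2 * s * (1 - s) * P + s\<^sup>2 * Q h"
    by (simp add: Q_def P_def sum.distrib sum_distrib_left)
  also have "\<dots> \<le> (1 - s)\<^sup>2 * Q g + 2 * s * (1 - s) * (m / 4) + s\<^sup>2 * B"
    using s h by (intro add_mono mult_left_mono) (auto simp: P_def)
  also have "\<dots> = Q g - 2 * (s * Q g) + s\<^sup>2 * Q g + s * m / 2 - s\<^sup>2 * m / 2 + s\<^sup>2 * B"
    by (simp add: power2_eq_square algebra_simps)
  also have "\<dots> \<le> Q g - 2 * (s * m) + s\<^sup>2 * (m + 1) + s * m / 2 + s\<^sup>2 * B"
  proof -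
    have "s * m \<le> s * Q g" "s\<^sup>2 * Q g \<le> s\<^sup>2 * (m + 1)" "0 \<le> s\<^sup>2 * m"
      using m_le[OF g(1)] g(2) s \<open>m > 0\<close> by (auto intro!: mult_left_mono)
    then show ?thesis by linarith
  qed
  also have "\<dots> = Q g - 3 / 2 * (s * m) + s * (s * C)"
    by (simp add: C_def power2_eq_square algebra_simps)
  also have "\<dots> = Q g - s * m"
    by (simp add: s(3))
  also have "\<dots> < m"
    using g(2) by simp
  finally show False
    using m_le[OF \<open>k \<in> K\<close>] by simp
qed

section \<open>The supremum norm, its dual, and means\<close>

lemma abs_le_sup_norm:
  assumes "g \<in> bounded_functions"
  shows "\<bar>g t\<bar> \<le> sup_norm g"
proof -
  obtain B where "\<forall>t. \<bar>g t\<bar> \<le> B"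
    using assms by (auto simp: bounded_functions_def bounded_iff)
  then have "bdd_above (range (\<lambda>t. \<bar>g t\<bar>))"
    by (intro bdd_aboveI2) auto
  then show ?thesis
    unfolding sup_norm_def by (intro cSUP_upper) auto
qed

lemma sup_norm_le:
  assumes "\<And>t. \<bar>g t\<bar> \<le> B"
  shows "sup_norm g \<le> B"
  unfolding sup_norm_def using assms by (intro cSUP_least) auto

lemma sup_dual_add: "\<mu> \<in> sup_dual X \<Longrightarrow> g \<in> X \<Longrightarrow> h \<in> X \<Longrightarrow> \<mu> (g + h) = \<mu> g + \<mu> h"
  by (auto simp: sup_dual_def)

lemma sup_dual_scaleR: "\<mu> \<in> sup_dual X \<Longrightarrow> g \<in> X \<Longrightarrow> \<mu> (c *\<^sub>R g) = c * \<mu> g"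
  by (auto simp: sup_dual_def)

lemma sup_dual_small:
  assumes "subspace X" "\<mu> \<in> sup_dual X" "\<epsilon> > 0"
  obtains \<delta> where "\<delta> > 0" "\<And>h. h \<in> X \<Longrightarrow> sup_norm h < \<delta> \<Longrightarrow> \<bar>\<mu> h\<bar> < \<epsilon>"
proof -
  have "0 \<in> X" using assms(1) by (rule subspace_0)
  then have "\<mu> 0 = 0" using sup_dual_scaleR[OF assms(2), of 0 0] by simp
  moreover obtain \<delta> where "\<delta> > 0" "\<forall>h\<in>X. sup_norm (h - 0) < \<delta> \<longrightarrow> \<bar>\<mu> h - \<mu> 0\<bar> < \<epsilon>"
    using assms(2,3) \<open>0 \<in> X\<close> unfolding sup_dual_def by blast
  ultimately show thesis using that by auto
qed

text \<open>The real supremum in \<open>dual_norm\<close> is an upper bound only once its range is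
  known to be bounded. Continuity at 0 provides this: scaling the unit ball by
  \<open>\<delta> / 2\<close> puts it strictly inside radius \<open>\<delta>\<close>, so
  \<open>2 / \<delta>\<close> bounds \<open>\<mu>\<close> there.\<close>

lemma abs_le_dual_norm:
  assumes "subspace X" "X \<subseteq> bounded_functions" "\<mu> \<in> sup_dual X" "g \<in> X" "sup_norm g \<le> 1"
  shows "\<bar>\<mu> g\<bar> \<le> dual_norm X \<mu>"
proof -
  obtain \<delta> where \<delta>: "\<delta> > 0" "\<And>h. h \<in> X \<Longrightarrow> sup_norm h < \<delta> \<Longrightarrow> \<bar>\<mu> h\<bar> < 1"
    using sup_dual_small[OF assms(1,3), of 1] by auto
  have "\<bar>\<mu> h\<bar> \<le> 2 / \<delta>" if h: "h \<in> X" "sup_norm h \<le> 1" for h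
  proof -
    have "\<bar>h t\<bar> \<le> 1" for t
      using abs_le_sup_norm[of h t] h assms(2) by auto
    then have "sup_norm ((\<delta> / 2) *\<^sub>R h) \<le> \<delta> / 2"
      using \<delta>(1) by (intro sup_norm_le) (simp add: abs_mult mult_left_le)
    then have "\<bar>\<mu> ((\<delta> / 2) *\<^sub>R h)\<bar> < 1"
      using \<delta> h assms(1) by (intro \<delta>(2)) (auto intro: subspace_scale)
    then show ?thesis
      using \<delta>(1) sup_dual_scaleR[OF assms(3) h(1)] by (simp add: abs_mult field_simps)
  qed
  then have "bdd_above ((\<lambda>h. \<bar>\<mu> h\<bar>) ` {h \<in> X. sup_norm h \<le> 1})"
    by (intro bdd_aboveI2) auto
  then show ?thesis
    unfolding dual_norm_def using assms(4,5) by (intro cSUP_upper) auto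
qed

text \<open>Positivity follows from the norm condition: \<open>k = 1 - (g - b) / c\<close> takes
  values in the unit interval for large \<open>c\<close>, so \<open>\<mu> k \<le> 1\<close>, while
  linearity gives \<open>\<mu> k = 1 - (\<mu> g - b) / c\<close>.\<close>

lemma mean_ge:
  assumes "subspace X" "X \<subseteq> bounded_functions" "1 \<in> X" "is_mean X \<mu>" "g \<in> X"
    and "\<And>t. b \<le> g t"
  shows "b \<le> \<mu> g"
proof -
  have \<mu>: "\<mu> \<in> sup_dual X" "dual_norm X \<mu> = 1" "\<mu> 1 = 1"
    using assms(4) by (auto simp: is_mean_def)
  \<comment> \<open>This dominates \<open>g t - b\<close> for every \<open>t\<close>; the summand 1
    makes \<open>c\<close> strictly positive.\<close>
  define c where "c = sup_norm g + \<bar>b\<bar> + 1"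
  have g: "\<bar>g t\<bar> \<le> sup_norm g" for t
    using assms(2,5) by (intro abs_le_sup_norm) auto
  have "c > 0" using g[of undefined] by (simp add: c_def)
  define k where "k = (1 + b / c) *\<^sub>R 1 + (- (1 / c)) *\<^sub>R g"
  have k: "k t = 1 - (g t - b) / c" for t
    by (simp add: k_def diff_divide_distrib)
  have "k \<in> X"
    unfolding k_def using assms(1,3,5) by (intro subspace_add subspace_scale)
  have "\<bar>k t\<bar> \<le> 1" for t
  proof -
    have "0 \<le> g t - b" "g t - b \<le> c"
      using assms(6)[of t] g[of t] by (auto simp: c_def)
    then show ?thesis
      using \<open>c > 0\<close> by (simp add: k abs_le_iff field_simps)
  qed
  then have "\<bar>\<mu> k\<bar> \<le> 1"
    using abs_le_dual_norm[OF assms(1,2) \<mu>(1) \<open>k \<in> X\<close>] sup_norm_le[of k 1] \<mu>(2) by simp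
  moreover have "\<mu> k = (1 + b / c) * \<mu> 1 + (- (1 / c)) * \<mu> g"
    unfolding k_def using assms(1,3,5)
    by (subst sup_dual_add[OF \<mu>(1)])
      (auto intro: subspace_scale simp del: scaleR_minus_left simp: sup_dual_scaleR[OF \<mu>(1)])
  ultimately show ?thesis
    using \<open>c > 0\<close> \<mu>(3) by (simp add: abs_le_iff field_simps)
qed

section \<open>Continuous functionals and the weak* topology\<close>

lemma continuous_scaleR_topological_vector_space:
  "continuous_on UNIV (\<lambda>x::'d::topological_vector_space. c *\<^sub>R x)"
proof -
  have "((\<lambda>y. c *\<^sub>R y) \<longlongrightarrow> c *\<^sub>R x) (at x)" for x :: 'd
  proof -
    have "LIM y at x. (c, y) :> nhds c \<times>\<^sub>F nhds x"
      by (intro filterlim_Pair tendsto_const tendsto_ident_at)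
    from filterlim_compose[OF tendsto_scaleR_Pair this] show ?thesis by simp
  qed
  then show ?thesis
    by (simp add: continuous_on_def)
qed

text \<open>Smallness near 0 is carried to any point \<open>x\<close> by translation, since
  \<open>F y - F x = F (y - x)\<close>.\<close>

lemma continuous_linear_functional:
  fixes F :: "'d::topological_vector_space \<Rightarrow> real"
  assumes "linear F"
    and small: "\<And>\<epsilon>. \<epsilon> > 0 \<Longrightarrow> \<exists>W. open W \<and> 0 \<in> W \<and> (\<forall>x\<in>W. \<bar>F x\<bar> < \<epsilon>)"
  shows "continuous_on UNIV F"
proof -
  have "(F \<longlongrightarrow> F x) (at x)" for x
  proof (rule tendstoI)
    fix \<epsilon> :: real assume "\<epsilon> > 0"
    then obtain W where W: "open W" "0 \<in> W" "\<forall>x\<in>W. \<bar>F x\<bar> < \<epsilon>"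
      using small by blast
    have "open ((\<lambda>y. y - x) -` W)"
      using W(1) by (intro open_vimage continuous_on_diff continuous_on_id continuous_on_const)
    then show "\<forall>\<^sub>F y in at x. dist (F y) (F x) < \<epsilon>"
      unfolding eventually_at_topological
      using W(2,3) linear_diff[OF assms(1)] by (auto simp: dist_real_def intro!: exI)
  qed
  then show ?thesis
    by (simp add: continuous_on_def)
qed

lemma convex_continuous_dual: "convex (continuous_dual :: ('d::locally_convex_space \<Rightarrow> real) set)"
proof (rule convexI)
  fix e e' :: "'d \<Rightarrow> real" and u v :: real
  assume e: "e \<in> continuous_dual" "e' \<in> continuous_dual"
  have eq: "u *\<^sub>R e + v *\<^sub>R e' = (\<lambda>x. u *\<^sub>R e x + v *\<^sub>R e' x)" by auto
  show "u *\<^sub>R e + v *\<^sub>R e' \<in> continuous_dual"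
    using e unfolding continuous_dual_def eq
    by (auto intro!: continuous_intros simp: linear_iff algebra_simps)
qed

text \<open>A basic neighbourhood in the product topology restricts finitely many coordinates
  \<open>J\<close>, and a small sum of squares over \<open>J\<close> controls each of them.\<close>

lemma weak_star_closure_ofI:
  fixes K :: "('d::locally_convex_space \<Rightarrow> real) set"
  assumes "F \<in> continuous_dual" "K \<subseteq> continuous_dual"
    and approx: "\<And>J \<epsilon>. finite J \<Longrightarrow> \<epsilon> > 0 \<Longrightarrow> \<exists>g\<in>K. (\<Sum>j\<in>J. (g j - F j)\<^sup>2) < \<epsilon>"
  shows "F \<in> weak_star closure_of K"
  unfolding in_closure_of
proof (intro conjI allI impI)
  show "F \<in> topspace weak_star"
    using assms(1) by (simp add: weak_star_def)
next
  fix T assume T: "F \<in> T \<and> openin weak_star T"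
  then obtain T' where T': "openin (powertop_real UNIV) T'" "T = T' \<inter> continuous_dual"
    by (auto simp: weak_star_def openin_subtopology)
  then obtain V where V: "finite {i. V i \<noteq> UNIV}" "\<forall>i. open (V i)"
      "F \<in> Pi\<^sub>E UNIV V" "Pi\<^sub>E UNIV V \<subseteq> T'"
    using T by (auto simp: openin_product_topology_alt)
  define J where "J = {i. V i \<noteq> UNIV}"
  have "\<forall>j. \<exists>e>0. ball (F j) e \<subseteq> V j"
    using V by (auto simp: PiE_iff open_contains_ball)
  then obtain e where e: "\<And>j. e j > 0" "\<And>j. ball (F j) (e j) \<subseteq> V j" by metis
  \<comment> \<open>The inserted 1 keeps the minimum meaningful when \<open>J\<close> is
    empty.\<close>
  define \<epsilon> where "\<epsilon> = Min (insert 1 (e ` J))"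
  have "finite J" using V(1) by (simp add: J_def)
  then have "\<epsilon> > 0" and \<epsilon>_le: "\<And>j. j \<in> J \<Longrightarrow> \<epsilon> \<le> e j"
    using e(1) by (auto simp: \<epsilon>_def)
  then obtain g where g: "g \<in> K" "(\<Sum>j\<in>J. (g j - F j)\<^sup>2) < \<epsilon>\<^sup>2"
    using approx[OF \<open>finite J\<close>, of "\<epsilon>\<^sup>2"] by auto
  have "g j \<in> V j" for j
  proof (cases "j \<in> J")
    case True
    then have "(g j - F j)\<^sup>2 \<le> (\<Sum>j\<in>J. (g j - F j)\<^sup>2)"
      using \<open>finite J\<close> by (intro member_le_sum) auto
    then have "\<bar>g j - F j\<bar> < \<epsilon>"
      using g(2) \<open>\<epsilon> > 0\<close> by (intro power2_less_imp_less[of "\<bar>g j - F j\<bar>"]) auto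
    then show ?thesis
      using e(2)[of j] \<epsilon>_le[OF True] by (auto simp: subset_iff dist_real_def)
  qed (simp add: J_def)
  then have "g \<in> Pi\<^sub>E UNIV V" by (simp add: PiE_iff)
  then show "\<exists>y. y \<in> K \<and> y \<in> T"
    using g(1) V(4) T'(2) assms(2) by blast
qed

theorem lemma6p1:
  fixes U :: "'d::locally_convex_space set"
    and f :: "'s::semigroup_mult \<Rightarrow> 'd \<Rightarrow> real"
    and X :: "('s \<Rightarrow> real) set"
  assumes "convex U" and "0 \<in> interior U"
    and "\<And>t. f t \<in> continuous_dual"
    and "\<And>t x. x \<in> U \<Longrightarrow> f t x \<le> 1"
    and "X \<subseteq> bounded_functions" and "subspace X"
    and "\<And>x. (\<lambda>t. f t x) \<in> X"
  shows "\<forall>\<mu>\<in>sup_dual X.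
    (\<exists>!F. F \<in> continuous_dual \<and> (\<forall>x. F x = \<mu> (\<lambda>t. f t x))) \<and>
    (\<forall>F. F \<in> continuous_dual \<and> (\<forall>x. F x = \<mu> (\<lambda>t. f t x)) \<longrightarrow>
      1 \<in> X \<and> is_mean X \<mu> \<longrightarrow> F \<in> weak_star closure_of (convex hull (range f)))"
proof (intro ballI conjI allI impI)
  fix \<mu> assume \<mu>: "\<mu> \<in> sup_dual X"
  have lin: "linear (f t)" for t
    using assms(3) by (simp add: continuous_dual_def)
  define F where "F = (\<lambda>x. \<mu> (\<lambda>t. f t x))"
  have "linear F"
  proof (rule linearI)
    fix x y
    have "(\<lambda>t. f t (x + y)) = (\<lambda>t. f t x) + (\<lambda>t. f t y)"
      by (auto simp: linear_add[OF lin])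
    then show "F (x + y) = F x + F y"
      using sup_dual_add[OF \<mu> assms(7) assms(7)] by (simp add: F_def)
  next
    fix c x
    have "(\<lambda>t. f t (c *\<^sub>R x)) = c *\<^sub>R (\<lambda>t. f t x)"
      by (auto simp: linear_scale[OF lin])
    then show "F (c *\<^sub>R x) = c *\<^sub>R F x"
      using sup_dual_scaleR[OF \<mu> assms(7)] by (simp add: F_def)
  qed
  moreover have "continuous_on UNIV F"
  proof (rule continuous_linear_functional[OF \<open>linear F\<close>])
    fix \<epsilon> :: real assume "\<epsilon> > 0"
    then obtain \<delta> where \<delta>: "\<delta> > 0" "\<And>h. h \<in> X \<Longrightarrow> sup_norm h < \<delta> \<Longrightarrow> \<bar>\<mu> h\<bar> < \<epsilon>"
      using sup_dual_small[OF assms(6) \<mu>] by blast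
    \<comment> \<open>Both signs are needed because \<open>f t\<close> is bounded on
      \<open>U\<close> only from above. The factor 2 yields the bound \<open>\<delta> / 2\<close>,
      which stays strictly below \<open>\<delta>\<close> after the supremum over
      \<open>t\<close>.\<close>
    define W where "W = (\<lambda>x. (2 / \<delta>) *\<^sub>R x) -` interior U \<inter> (\<lambda>x. (- (2 / \<delta>)) *\<^sub>R x) -` interior U"
    have "open W"
      unfolding W_def
      by (intro open_Int open_vimage open_interior continuous_scaleR_topological_vector_space)
    moreover have "0 \<in> W"
      using assms(2) by (simp add: W_def)
    moreover have "\<bar>F x\<bar> < \<epsilon>" if "x \<in> W" for x
    proof -
      have "\<bar>f t x\<bar> \<le> \<delta> / 2" for t
      proof -
        have "(2 / \<delta>) *\<^sub>R x \<in> U" "(- (2 / \<delta>)) *\<^sub>R x \<in> U"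
          using that interior_subset[of U] by (auto simp: W_def)
        from this[THEN assms(4), of t] show ?thesis
          using \<delta>(1) by (simp only: linear_scale[OF lin]) (simp add: abs_le_iff field_simps)
      qed
      then have "sup_norm (\<lambda>t. f t x) < \<delta>"
        using sup_norm_le[of "\<lambda>t. f t x" "\<delta> / 2"] \<delta>(1) by simp
      then show ?thesis
        using \<delta>(2) assms(7) by (simp add: F_def)
    qed
    ultimately show "\<exists>W. open W \<and> 0 \<in> W \<and> (\<forall>x\<in>W. \<bar>F x\<bar> < \<epsilon>)" by blast
  qed
  ultimately have "F \<in> continuous_dual"
    by (simp add: continuous_dual_def)
  \<comment> \<open>Uniqueness is extensionality, as the value at every \<open>x\<close> is
    prescribed.\<close>
  then show "\<exists>!F. F \<in> continuous_dual \<and> (\<forall>x. F x = \<mu> (\<lambda>t. f t x))"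
    by (auto simp: F_def)
next
  fix \<mu> F
  assume F: "F \<in> continuous_dual \<and> (\<forall>x. F x = \<mu> (\<lambda>t. f t x))" and mean: "1 \<in> X \<and> is_mean X \<mu>"
  have lin: "linear (f t)" "linear F" for t
    using assms(3) F by (auto simp: continuous_dual_def)
  show "F \<in> weak_star closure_of (convex hull (range f))"
  proof (rule weak_star_closure_ofI)
    show "F \<in> continuous_dual" using F by simp
    show "convex hull (range f) \<subseteq> continuous_dual"
      using assms(3) convex_continuous_dual by (intro hull_minimal) auto
    fix J :: "'d set" and \<epsilon> :: real assume "finite J" "\<epsilon> > 0"
    \<comment> \<open>Each \<open>\<lambda>t. f t j\<close> lies in \<open>X\<close> and is
      therefore bounded, so one \<open>B\<close> serves all \<open>t\<close>.\<close>
    define B where "B = (\<Sum>j\<in>J. (sup_norm (\<lambda>t. f t j) + \<bar>F j\<bar>)\<^sup>2)"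
    show "\<exists>g\<in>convex hull (range f). (\<Sum>j\<in>J. (g j - F j)\<^sup>2) < \<epsilon>"
    proof (rule convex_sum_squares_approx[where B = B])
      fix g and \<eta> :: real assume "\<eta> > 0"
      \<comment> \<open>The coordinates \<open>j\<close> are themselves vectors of the predual, so
        pairing with the weights \<open>g j - F j\<close> is evaluation at the single vector
        \<open>x\<close>. The mixed sum for \<open>f t\<close> becomes \<open>f t x - F x\<close>,
        to which \<open>mean_ge\<close> applies.\<close>
      define x where "x = (\<Sum>j\<in>J. (g j - F j) *\<^sub>R j)"
      have x: "e x = (\<Sum>j\<in>J. (g j - F j) * e j)" if "linear e" for e :: "'d \<Rightarrow> real"
        by (simp add: x_def linear_sum[OF that] linear_scale[OF that])
      have "\<exists>t. f t x < F x + \<eta>"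
      proof (rule ccontr)
        assume "\<not> ?thesis"
        then have "F x + \<eta> \<le> f t x" for t
          by (meson not_less)
        then have "F x + \<eta> \<le> \<mu> (\<lambda>t. f t x)"
          by (rule mean_ge[OF assms(6,5) conjunct1[OF mean] conjunct2[OF mean] assms(7)])
        then show False using F \<open>\<eta> > 0\<close> by simp
      qed
      then obtain t where "f t x < F x + \<eta>" by blast
      then have "(\<Sum>j\<in>J. (g j - F j) * (f t j - F j)) < \<eta>"
        by (simp add: x lin right_diff_distrib sum_subtractf)
      moreover have "(\<Sum>j\<in>J. (f t j - F j)\<^sup>2) \<le> B"
        unfolding B_def
      proof (rule sum_mono)
        fix j
        have "\<bar>f t j\<bar> \<le> sup_norm (\<lambda>t. f t j)"
          using assms(5,7) abs_le_sup_norm[of "\<lambda>t. f t j" t] by auto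
        then have "\<bar>f t j - F j\<bar> \<le> sup_norm (\<lambda>t. f t j) + \<bar>F j\<bar>" by linarith
        from power_mono[OF this, of 2] show "(f t j - F j)\<^sup>2 \<le> (sup_norm (\<lambda>t. f t j) + \<bar>F j\<bar>)\<^sup>2"
          by simp
      qed
      ultimately show "\<exists>h\<in>convex hull (range f).
          (\<Sum>j\<in>J. (h j - F j)\<^sup>2) \<le> B \<and> (\<Sum>j\<in>J. (g j - F j) * (h j - F j)) < \<eta>"
        using hull_inc[of "f t" "range f" convex] by blast
    qed (use \<open>\<epsilon> > 0\<close> in auto)
  qed
qed

end
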